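(* Let $A,B,C,S,(M_k),\gamma,(L_k),\mu,\beta$ satisfy the standing assumption stated in the context (constant step size $\gamma>0$), and assume that $A$ is $\rho$-strongly monotone w.r.t. $S$ for some $\rho>0$. Let $(x_k),(y_k),(u_k)$ be generated from arbitrary $x_{-1},x_0,u_0\in\mathcal H$ by, for $k=0,1,2,\dots$, $$y_k=2x_k-x_{k-1},\qquad x_{k+1}=(M_k+A)^{-1}\big(M_kx_k-By_k-Cx_k+\gamma^{-1}u_k\big),\qquad u_{k+1}=(\gamma M_k-S)x_{k+1}-(\gamma M_k-S)x_k .$$ Let $\varepsilon_2>0$ and put $$p_k=1-3L_k-\frac{(2+\varepsilon_2+2\varepsilon_2^2)\gamma\beta}{2\varepsilon_2}-L_{k-1}-\gamma\mu(\sqrt2+1)\ (k\ge1),\qquad q_k=1-L_{k-1}-L_{k-2}-\gamma\mu(\sqrt2+1)\ (k\ge2).$$ Assume there is $\epsilon>0$ such that $p_k\ge\epsilon$ for all integers $k\ge1$ and $q_k\ge\epsilon$ for all integers $k\ge2$, and that there exist $\varepsilon_3,\varepsilon_4>0$ such that $$t=\inf_{k\ge2}\ \min\left\{\frac{2\gamma\rho}{1+\frac{L_k}{\varepsilon_3}+2\varepsilon_4\gamma\mu},\ \frac{p_k}{1+5L_{k-1}+(\varepsilon_3+5)L_k+\gamma\beta+\gamma\mu\big(\frac1{\varepsilon_4}+\sqrt2+1\big)},\ \frac{q_k}{\gamma\mu(2\varepsilon_4+1)+4L_{k-1}}\right\}>0 .$$ Then $(x_k)_{k\in\mathbb N}$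 converges $R$-linearly to a point $x^*\in\operatorname{zer}(A+B+C)$.
   Context: $\mathcal H$ is a real Hilbert space. $S:\mathcal H\to\mathcal H$ is (bounded) linear, self-adjoint and strongly monotone, i.e. $\langle Sx,x\rangle\ge c\|x\|^2$ for some $c>0$ and all $x$; then $S^{-1}$ has the same properties. Put $\|x\|_S^2=\langle Sx,x\rangle$ and $\|x\|_{S^{-1}}^2=\langle S^{-1}x,x\rangle$. An operator $T:\mathcal H\to\mathcal H$ is $L$-Lipschitz w.r.t. $S$ if $\|Tx-Ty\|_{S^{-1}}\le L\|x-y\|_S$ for all $x,y$; it is $\beta^{-1}$-cocoercive w.r.t. $S$ (with $\beta>0$) if $\langle Tx-Ty,x-y\rangle\ge\beta^{-1}\|Tx-Ty\|_{S^{-1}}^2$ for all $x,y$. A set-valued $A$ is $\rho$-strongly monotone w.r.t. $S$ if $\langle u-v,x-y\rangle\ge\rho\|x-y\|_S^2$ for all $(x,u),(y,v)$ in its graph. Standing assumption: $A:\mathcal H\to2^{\mathcal H}$ is maximally monotone; $B:\mathcal H\to\mathcal H$ is single-valued, monotone and $\mu$-Lipschitz w.r.t. $S$ ($\mu>0$); $C:\mathcal H\to\mathcal H$ is $\beta^{-1}$-cocoercive w.r.t. $S$ for some $\beta>0$; $\operatorname{zer}(A+B+C)=\{x\in\mathcal H:0\in Ax+Bx+Cx\}$ is nonempty; $\gamma>0$ and, for every $k\in\mathbb N=\{0,1,2,\dots\}$, $M_k:\mathcal H\to\mathcal H$ is a (possibly nonlinear) operator such that $\gamma M_k-S$ is $L_k$-Lipschitz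 w.r.t. $S$ for some $L_k\in[0,1)$. Under this assumption each $(M_k+A)^{-1}$ is single-valued and defined on all of $\mathcal H$. $(x_k)$ converges $R$-linearly to $x^*$ if there are $c_0\ge0$ and $q\in(0,1)$ with $\|x_k-x^*\|\le c_0q^k$ for all sufficiently large $k$. *)

theory Defs
  imports "HOL-Analysis.Analysis"
begin

(* A real Hilbert space is a type of sort {real_inner, complete_space};
   a set-valued operator H -> 2^H is a function 'a => 'a set. *)

definition self_adjoint :: "('a::real_inner \<Rightarrow> 'a) \<Rightarrow> bool" where
  "self_adjoint S \<longleftrightarrow> (\<forall>x y. S x \<bullet> y = x \<bullet> S y)"

definition strongly_monotone_lin :: "('a::real_inner \<Rightarrow> 'a) \<Rightarrow> bool" where
  "strongly_monotone_lin S \<longleftrightarrow> (\<exists>c>0. \<forall>x. S x \<bullet> x \<ge> c * (norm x)\<^sup>2)"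

definition normS :: "('a::real_inner \<Rightarrow> 'a) \<Rightarrow> 'a \<Rightarrow> real" where
  "normS S x = sqrt (S x \<bullet> x)"

(* The norm of S^{-1} is normS (inv S). It is used only for bounded linear, self-adjoint,
   strongly monotone S on a Hilbert space; such S are bijective, so inv S is the true inverse. *)

definition lipschitz_wrt :: "('a::real_inner \<Rightarrow> 'a) \<Rightarrow> real \<Rightarrow> ('a \<Rightarrow> 'a) \<Rightarrow> bool" where
  "lipschitz_wrt S L T \<longleftrightarrow> (\<forall>x y. normS (inv S) (T x - T y) \<le> L * normS S (x - y))"

definition cocoercive_wrt :: "('a::real_inner \<Rightarrow> 'a) \<Rightarrow> real \<Rightarrow> ('a \<Rightarrow> 'a) \<Rightarrow> bool" where
  "cocoercive_wrt S \<sigma> T \<longleftrightarrow>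
     (\<forall>x y. (T x - T y) \<bullet> (x - y) \<ge> \<sigma> * (normS (inv S) (T x - T y))\<^sup>2)"

definition single :: "('a \<Rightarrow> 'a) \<Rightarrow> 'a \<Rightarrow> 'a set" where
  "single T = (\<lambda>x. {T x})"

definition op_plus :: "('a::plus \<Rightarrow> 'a set) \<Rightarrow> ('a \<Rightarrow> 'a set) \<Rightarrow> 'a \<Rightarrow> 'a set" where
  "op_plus A B = (\<lambda>x. {u + v |u v. u \<in> A x \<and> v \<in> B x})"

definition op_inverse :: "('a \<Rightarrow> 'a set) \<Rightarrow> 'a \<Rightarrow> 'a set" where
  "op_inverse A = (\<lambda>u. {x. u \<in> A x})"

definition zer :: "('a::zero \<Rightarrow> 'a set) \<Rightarrow> 'a set" where
  "zer A = {x. 0 \<in> A x}"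

definition gra :: "('a \<Rightarrow> 'a set) \<Rightarrow> ('a \<times> 'a) set" where
  "gra A = {(x, u). u \<in> A x}"

definition monotone_op :: "('a::real_inner \<Rightarrow> 'a set) \<Rightarrow> bool" where
  "monotone_op A \<longleftrightarrow> (\<forall>(x, u) \<in> gra A. \<forall>(y, v) \<in> gra A. (u - v) \<bullet> (x - y) \<ge> 0)"

definition maximally_monotone :: "('a::real_inner \<Rightarrow> 'a set) \<Rightarrow> bool" where
  "maximally_monotone A \<longleftrightarrow>
     monotone_op A \<and> (\<forall>A'. monotone_op A' \<and> gra A \<subseteq> gra A' \<longrightarrow> gra A' = gra A)"

definition strongly_monotone_wrt ::
  "('a::real_inner \<Rightarrow> 'a) \<Rightarrow> real \<Rightarrow> ('a \<Rightarrow> 'a set) \<Rightarrow> bool" where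
  "strongly_monotone_wrt S \<rho> A \<longleftrightarrow>
     (\<forall>(x, u) \<in> gra A. \<forall>(y, v) \<in> gra A. (u - v) \<bullet> (x - y) \<ge> \<rho> * (normS S (x - y))\<^sup>2)"

definition R_linearly_converges :: "(nat \<Rightarrow> 'a::real_normed_vector) \<Rightarrow> 'a \<Rightarrow> bool" where
  "R_linearly_converges x l \<longleftrightarrow>
     (\<exists>c0\<ge>0. \<exists>q. 0 < q \<and> q < 1 \<and> (\<forall>\<^sub>F k in sequentially. norm (x k - l) \<le> c0 * q ^ k))"

end

theory Submission
  imports Defs
begin

text \<open>
  Fix a zero \<open>z\<close>. Strong monotonicity of \<open>A\<close> between \<open>x\<^sub>k\<^sub>+\<^sub>1\<close> and \<open>z\<close>, monotonicity of \<open>A\<close> between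
  \<open>x\<^sub>k\<^sub>+\<^sub>1\<close> and \<open>x\<^sub>k\<close>, and monotonicity of \<open>B\<close> between \<open>y\<^sub>k\<close> and \<open>z\<close> combine into an estimate
  in which the indefinite terms telescope. The remaining cross terms are absorbed by Young
  inequalities, with weights such that \<open>p\<^sub>k\<close> and \<open>q\<^sub>k\<close> are exactly what is left of
  \<open>\<parallel>x\<^sub>k\<^sub>+\<^sub>1 - x\<^sub>k\<parallel>\<^sup>2\<close> and \<open>\<parallel>x\<^sub>k\<^sub>+\<^sub>1 - y\<^sub>k\<parallel>\<^sup>2\<close>. This gives an energy
  that dominates \<open>\<parallel>x\<^sub>k - z\<parallel>\<^sup>2\<close> and whose decrease controls a fixed fraction of the energy itself.
\<close>

section \<open>Geometry of the norm induced by \<open>S\<close> and of its dual norm\<close>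

locale energy_operator =
  fixes S :: "'a::{real_inner, complete_space} \<Rightarrow> 'a"
  assumes bounded_linear: "bounded_linear S"
    and self_adjoint: "self_adjoint S"
    and strongly_monotone: "strongly_monotone_lin S"
begin

sublocale bounded_linear S
  by (rule bounded_linear)

abbreviation N :: "'a \<Rightarrow> real" where "N \<equiv> normS S"
abbreviation N' :: "'a \<Rightarrow> real" where "N' \<equiv> normS (inv S)"

lemma symmetric: "S a \<bullet> b = S b \<bullet> a"
  using self_adjoint unfolding self_adjoint_def by (metis inner_commute)

lemma form_nonneg: "0 \<le> S a \<bullet> a"
proof -
  obtain c where "c > 0" "\<forall>x. S x \<bullet> x \<ge> c * (norm x)\<^sup>2"
    using strongly_monotone unfolding strongly_monotone_lin_def by blast
  then show ?thesis
    by (meson less_eq_real_def mult_nonneg_nonneg order_trans zero_le_power2)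
qed

lemma N_nonneg: "0 \<le> N a"
  by (simp add: normS_def form_nonneg)

lemma N_sq: "(N a)\<^sup>2 = S a \<bullet> a"
  by (simp add: normS_def form_nonneg)

lemma N_minus_commute: "N (a - b) = N (b - a)"
  by (simp add: normS_def diff inner_diff)

lemma N_pos: "a \<noteq> 0 \<Longrightarrow> 0 < S a \<bullet> a"
proof -
  assume a: "a \<noteq> 0"
  obtain c where "c > 0" "\<forall>x. S x \<bullet> x \<ge> c * (norm x)\<^sup>2"
    using strongly_monotone unfolding strongly_monotone_lin_def by blast
  moreover from this a have "0 < c * (norm a)\<^sup>2" by simp
  ultimately show ?thesis by (meson less_le_trans)
qed

text \<open>Nonnegativity of the form at \<open>a - s *\<^sub>R b\<close>, for the \<open>s\<close>
  that minimises it, is the discriminant inequality.\<close>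

lemma form_Cauchy_Schwarz: "S a \<bullet> b \<le> N a * N b"
proof (cases "b = 0")
  case True
  then show ?thesis by (simp add: normS_def zero)
next
  case False
  then have pos: "0 < S b \<bullet> b" by (rule N_pos)
  define s where "s = (S a \<bullet> b) / (S b \<bullet> b)"
  have "0 \<le> S (a - s *\<^sub>R b) \<bullet> (a - s *\<^sub>R b)" by (rule form_nonneg)
  also have "\<dots> = S a \<bullet> a - 2 * s * (S a \<bullet> b) + s * s * (S b \<bullet> b)"
    by (simp add: diff scaleR inner_diff symmetric[of b a]
        algebra_simps)
  also have "\<dots> = S a \<bullet> a - (S a \<bullet> b)\<^sup>2 / (S b \<bullet> b)"
    using pos by (simp add: s_def power2_eq_square)
  finally have "(S a \<bullet> b)\<^sup>2 \<le> (S a \<bullet> a) * (S b \<bullet> b)"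
    using pos by (simp add: field_simps)
  then have "(S a \<bullet> b)\<^sup>2 \<le> (N a * N b)\<^sup>2"
    by (simp add: power_mult_distrib N_sq)
  then show ?thesis
    using N_nonneg by (meson mult_nonneg_nonneg power2_le_imp_le)
qed

lemma N_triangle: "N (a + b) \<le> N a + N b"
proof -
  have "(N (a + b))\<^sup>2 = (N a)\<^sup>2 + 2 * (S a \<bullet> b) + (N b)\<^sup>2"
    by (simp add: N_sq add inner_add symmetric[of b a])
  also have "\<dots> \<le> (N a + N b)\<^sup>2"
    using form_Cauchy_Schwarz[of a b] by (simp add: power2_sum)
  finally show ?thesis
    using N_nonneg by (meson add_nonneg_nonneg power2_le_imp_le)
qed

text \<open>For small \<open>\<tau>\<close> the map \<open>z \<mapsto> z - \<tau> (S z - b)\<close> is a contraction.\<close>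
lemma surj_S: "surj S"
proof -
  obtain c where c: "c > 0" "\<And>x. S x \<bullet> x \<ge> c * (norm x)\<^sup>2"
    using strongly_monotone unfolding strongly_monotone_lin_def by blast
  obtain K where K: "K > 0" "\<And>x. norm (S x) \<le> norm x * K"
    using pos_bounded by blast
  \<comment> \<open>Taking \<open>m \<ge> c\<close> keeps the radicand in \<open>r\<close>
    nonnegative; \<open>\<tau>\<close> minimises
    \<open>1 - 2 * \<tau> * c + \<tau>\<^sup>2 * m\<^sup>2\<close>, the bound for the squared
    contraction factor.\<close>
  define m where "m = max K c"
  have m: "m > 0" "m \<ge> K" "m \<ge> c" using K(1) by (auto simp: m_def)
  define \<tau> where "\<tau> = c / m\<^sup>2"
  define r where "r = sqrt (1 - c\<^sup>2 / m\<^sup>2)"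
  have cm: "0 < c\<^sup>2 / m\<^sup>2" "c\<^sup>2 / m\<^sup>2 \<le> 1"
    using c(1) m by (auto simp: power_mono)
  have r: "0 \<le> r" "r < 1" using cm by (auto simp: r_def)
  have contract: "norm (a - \<tau> *\<^sub>R S a) \<le> r * norm a" for a
  proof -
    have "(norm (S a))\<^sup>2 \<le> (norm a * m)\<^sup>2"
      using K(2)[of a] mult_left_mono[OF m(2) norm_ge_zero[of a]] by (intro power_mono) auto
    then have 1: "\<tau>\<^sup>2 * (norm (S a))\<^sup>2 \<le> \<tau>\<^sup>2 * (m\<^sup>2 * (norm a)\<^sup>2)"
      by (intro mult_left_mono) (auto simp: power_mult_distrib mult.commute)
    have 2: "\<tau> * (c * (norm a)\<^sup>2) \<le> \<tau> * (S a \<bullet> a)"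
      using c m by (intro mult_left_mono) (auto simp: \<tau>_def)
    have "(norm (a - \<tau> *\<^sub>R S a))\<^sup>2 = (norm a)\<^sup>2 - 2 * \<tau> * (S a \<bullet> a) + \<tau>\<^sup>2 * (norm (S a))\<^sup>2"
      by (simp add: power2_norm_eq_inner power2_eq_square[of \<tau>] inner_diff inner_commute algebra_simps)
    also have "\<dots> \<le> (norm a)\<^sup>2 - 2 * (\<tau> * (c * (norm a)\<^sup>2)) + \<tau>\<^sup>2 * (m\<^sup>2 * (norm a)\<^sup>2)"
      using 1 2 by linarith
    also have "\<dots> = (1 - c\<^sup>2 / m\<^sup>2) * (norm a)\<^sup>2"
      using m(1) by (simp add: \<tau>_def field_simps power2_eq_square)
    also have "\<dots> = (r * norm a)\<^sup>2"
      using cm by (simp add: r_def power_mult_distrib)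
    finally show ?thesis
      using r by (meson mult_nonneg_nonneg norm_ge_zero power2_le_imp_le)
  qed
  have "\<exists>z. S z = b" for b
  proof -
    have "\<exists>!z\<in>UNIV. z - \<tau> *\<^sub>R (S z - b) = z"
    proof (rule Banach_fix[OF complete_UNIV _ r])
      fix x y
      have "x - \<tau> *\<^sub>R (S x - b) - (y - \<tau> *\<^sub>R (S y - b)) = (x - y) - \<tau> *\<^sub>R S (x - y)"
        by (simp add: diff algebra_simps)
      then show "dist (x - \<tau> *\<^sub>R (S x - b)) (y - \<tau> *\<^sub>R (S y - b)) \<le> r * dist x y"
        using contract[of "x - y"] by (simp only: dist_norm)
    qed auto
    then obtain z where "z - \<tau> *\<^sub>R (S z - b) = z" by blast
    then have "\<tau> *\<^sub>R (S z - b) = 0" by simp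
    moreover have "\<tau> \<noteq> 0" using c(1) m(1) by (simp add: \<tau>_def)
    ultimately show ?thesis by auto
  qed
  then show ?thesis by (metis surjI)
qed

text \<open>Writing \<open>a = S (inv S a)\<close> moves the dual norm to the primal side, so that
  facts about \<open>N\<close> carry over directly.\<close>

lemma N'_eq: "N' a = N (inv S a)"
  by (simp add: normS_def inner_commute surj_f_inv_f[OF surj_S])

lemma N'_nonneg: "0 \<le> N' a"
  by (simp add: N'_eq N_nonneg)

lemma dual_Cauchy_Schwarz: "a \<bullet> b \<le> N' a * N b"
  using form_Cauchy_Schwarz[of "inv S a" b] by (simp add: N'_eq surj_f_inv_f[OF surj_S])

text \<open>The opposite sign comes from replacing \<open>b\<close> by \<open>- b\<close>. The
  product \<open>l * n\<close> is the shape in which Lipschitz conditions provide bounds.\<close>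

lemma dual_bound:
  assumes "N' a \<le> l * n"
  shows "\<bar>a \<bullet> b\<bar> \<le> l * n * N b"
proof -
  have "a \<bullet> b \<le> N' a * N b" by (rule dual_Cauchy_Schwarz)
  moreover have "- (a \<bullet> b) \<le> N' a * N b"
    using dual_Cauchy_Schwarz[of a "- b"] by (simp add: normS_def neg)
  moreover have "N' a * N b \<le> l * n * N b"
    using assms N_nonneg by (rule mult_right_mono)
  ultimately show ?thesis by linarith
qed

text \<open>Young's inequality with equal weights charges the Lipschitz constant \<open>l\<close>
  equally to both squares.\<close>

lemma dual_Young:
  assumes "N' a \<le> l * n" "0 \<le> l"
  shows "\<bar>2 * (a \<bullet> b)\<bar> \<le> l * n\<^sup>2 + l * (N b)\<^sup>2"
proof -
  have "\<bar>2 * (a \<bullet> b)\<bar> \<le> l * (2 * n * N b)"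
    using dual_bound[OF assms(1), of b] by (simp add: abs_mult)
  also have "\<dots> \<le> l * (n\<^sup>2 + (N b)\<^sup>2)"
    using assms(2) sum_squares_bound[of n "N b"] by (intro mult_left_mono) auto
  finally show ?thesis by (simp add: algebra_simps)
qed

text \<open>An upper bound of the inner product by dual Cauchy-Schwarz leaves a common factor
  \<open>?n\<close> to cancel; if it vanishes the claim is trivial.\<close>

lemma cocoercive_imp_lipschitz:
  assumes "cocoercive_wrt S (inverse \<beta>) C" "\<beta> > 0"
  shows "lipschitz_wrt S \<beta> C"
  unfolding lipschitz_wrt_def
proof (intro allI)
  fix a b
  let ?n = "N' (C a - C b)"
  have "inverse \<beta> * ?n\<^sup>2 \<le> (C a - C b) \<bullet> (a - b)"
    using assms(1) by (simp add: cocoercive_wrt_def)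
  also have "\<dots> \<le> ?n * N (a - b)" by (rule dual_Cauchy_Schwarz)
  finally have "?n * ?n \<le> ?n * (\<beta> * N (a - b))"
    using assms(2) by (simp add: field_simps power2_eq_square)
  then show "?n \<le> \<beta> * N (a - b)"
    using N'_nonneg[of "C a - C b"] N_nonneg[of "a - b"] assms(2)
    by (cases "?n = 0") (auto simp: mult_le_cancel_left)
qed

section \<open>One-step energy estimates\<close>

text \<open>In use \<open>w\<close> is \<open>x_k - z\<close>, \<open>d\<close> and
  \<open>d'\<close> are the increments of \<open>x\<close> into and out of \<open>x_k\<close>, and
  \<open>w + d\<close> is \<open>y_k - z\<close>. Twice the sum of the hypotheses is rearranged by
  polarization of \<open>S d' \<bullet> (w + d')\<close> and \<open>S (d' - d) \<bullet> d'\<close>;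
  the third hypothesis leaves of the \<open>b\<close> terms a telescoping pair and a product of
  increments.\<close>

lemma telescoping_estimate:
  assumes strong: "\<gamma> * \<rho> * (N (w + d'))\<^sup>2
      \<le> (u - u' - S d' - \<gamma> *\<^sub>R b' - \<gamma> *\<^sub>R c') \<bullet> (w + d')"
    and mono: "0 \<le> (2 *\<^sub>R u - u' - u\<^sub>0 - S d' + S d - \<gamma> *\<^sub>R (b' - b) - \<gamma> *\<^sub>R (c' - c)) \<bullet> d'"
    and b': "0 \<le> \<gamma> * (b' \<bullet> (w + d))"
  shows "(1 + 2 * \<gamma> * \<rho>) * (N (w + d'))\<^sup>2 + 2 * (N d')\<^sup>2 + (N (d' - d))\<^sup>2
      + 2 * (u' \<bullet> (w + d')) + 2 * ((u' - u) \<bullet> d') + 2 * \<gamma> * (b' \<bullet> d')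
    \<le> (N w)\<^sup>2 + (N d)\<^sup>2 + 2 * (u \<bullet> w) + 2 * ((u - u\<^sub>0) \<bullet> d) + 2 * \<gamma> * (b \<bullet> d)
      + 2 * (u \<bullet> d') + 2 * ((u - u\<^sub>0) \<bullet> (d' - d)) - 2 * \<gamma> * ((b' - b) \<bullet> (d' - d))
      - 2 * \<gamma> * (c' \<bullet> w + c' \<bullet> d') - 2 * \<gamma> * ((c' - c) \<bullet> d')"
  using strong mono b' symmetric[of d d'] symmetric[of w d']
  by (simp add: N_sq add diff algebra_simps)

text \<open>The terms that do not telescope are split into squares. Here \<open>l\<^sub>1\<close>
  and \<open>l\<^sub>0\<close> stand for \<open>L_{k-1}\<close> and \<open>L_{k-2}\<close>,
  \<open>e\<close> for \<open>x_k - y_{k-1}\<close>, and \<open>\<epsilon>\<close> for the free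
  weight \<open>\<epsilon>2\<close>.\<close>

lemma energy_step:
  assumes strong: "\<gamma> * \<rho> * (N (w + d'))\<^sup>2
      \<le> (u - u' - S d' - \<gamma> *\<^sub>R b' - \<gamma> *\<^sub>R c') \<bullet> (w + d')"
    and mono: "0 \<le> (2 *\<^sub>R u - u' - u\<^sub>0 - S d' + S d - \<gamma> *\<^sub>R (b' - b) - \<gamma> *\<^sub>R (c' - c)) \<bullet> d'"
    and b': "0 \<le> b' \<bullet> (w + d)"
    and u: "N' u \<le> l\<^sub>1 * N d" and u0: "N' u\<^sub>0 \<le> l\<^sub>0 * N d\<^sub>0"
    and l: "0 \<le> l\<^sub>1" "0 \<le> l\<^sub>0"
    and b: "N' (b' - b) \<le> \<mu> * (N d + N e)"
    and c': "inverse \<beta> * (N' c')\<^sup>2 \<le> c' \<bullet> w"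
    and c: "N' (c' - c) \<le> \<beta> * N d"
    and pos: "0 < \<gamma>" "0 < \<mu>" "0 < \<beta>" "0 < \<epsilon>"
  shows "(1 + 2 * \<gamma> * \<rho>) * (N (w + d'))\<^sup>2
      + (2 - l\<^sub>1 - \<gamma> * \<beta> / 2 - \<gamma> * \<beta> * \<epsilon>) * (N d')\<^sup>2
      + (1 - \<gamma> * \<mu> * sqrt 2 - l\<^sub>1 - l\<^sub>0) * (N (d' - d))\<^sup>2
      + 2 * (u' \<bullet> (w + d')) + 2 * ((u' - u) \<bullet> d') + 2 * \<gamma> * (b' \<bullet> d')
    \<le> (N w)\<^sup>2 + 2 * (u \<bullet> w) + 2 * ((u - u\<^sub>0) \<bullet> d) + 2 * \<gamma> * (b \<bullet> d)
      + (1 + \<gamma> * \<mu> * (sqrt 2 + 1) + 2 * l\<^sub>1 + \<gamma> * \<beta> / \<epsilon>) * (N d)\<^sup>2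
      + l\<^sub>0 * (N d\<^sub>0)\<^sup>2 + \<gamma> * \<mu> * (N e)\<^sup>2"
proof -
  define D where "D = N d"
  define D' where "D' = N d'"
  define E where "E = N e"
  define E' where "E' = N (d' - d)"
  have u_d': "2 * (u \<bullet> d') \<le> l\<^sub>1 * D\<^sup>2 + l\<^sub>1 * D'\<^sup>2"
    using dual_Young[OF u l(1), of d'] by (simp add: D_def D'_def)
  have u_e': "2 * ((u - u\<^sub>0) \<bullet> (d' - d)) \<le> l\<^sub>1 * D\<^sup>2 + l\<^sub>1 * E'\<^sup>2 + l\<^sub>0 * (N d\<^sub>0)\<^sup>2 + l\<^sub>0 * E'\<^sup>2"
    using dual_Young[OF u l(1), of "d' - d"] dual_Young[OF u0 l(2), of "d' - d"]
    unfolding D_def E'_def inner_diff_left[of u u\<^sub>0] right_diff_distrib by linarith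
  have b_e': "- (2 * \<gamma> * ((b' - b) \<bullet> (d' - d)))
      \<le> \<gamma> * \<mu> * (sqrt 2 + 1) * D\<^sup>2 + \<gamma> * \<mu> * E\<^sup>2 + \<gamma> * \<mu> * sqrt 2 * E'\<^sup>2"
  proof -
    define s where "s = sqrt (2::real)"
    have s: "s * s = 2" "s > 0" by (auto simp: s_def)
    \<comment> \<open>A sum-of-squares certificate: since \<open>s * s = 2\<close>, this expression
      is \<open>s\<close> times the gap in the inequality \<open>*\<close> below. It produces the
      constant \<open>sqrt 2 + 1\<close>.\<close>
    have "0 \<le> (D + E - s * E')\<^sup>2 + ((s + 1) * D - E)\<^sup>2 * (s - 1)"
      using real_le_rsqrt[of 1 2] by (simp add: s_def)
    also have "\<dots> = s * ((s + 1) * D\<^sup>2 + E\<^sup>2 + s * E'\<^sup>2 - 2 * (D + E) * E')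
        + (s * s - 2) * (s * D\<^sup>2 - 2 * D * E)"
      by (simp add: power2_eq_square algebra_simps)
    also have "\<dots> = s * ((s + 1) * D\<^sup>2 + E\<^sup>2 + s * E'\<^sup>2 - 2 * (D + E) * E')"
      by (simp add: s)
    finally have *: "2 * (D + E) * E' \<le> (s + 1) * D\<^sup>2 + E\<^sup>2 + s * E'\<^sup>2"
      using s(2) by (simp add: zero_le_mult_iff)
    have "- (2 * \<gamma> * ((b' - b) \<bullet> (d' - d))) = 2 * \<gamma> * (- ((b' - b) \<bullet> (d' - d)))" by simp
    also have "\<dots> \<le> 2 * \<gamma> * (\<mu> * (D + E) * E')"
      using dual_bound[OF b, of "d' - d"] pos by (intro mult_left_mono) (auto simp: D_def E_def E'_def)
    also have "\<dots> = \<gamma> * \<mu> * (2 * (D + E) * E')" by simp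
    also have "\<dots> \<le> \<gamma> * \<mu> * ((s + 1) * D\<^sup>2 + E\<^sup>2 + s * E'\<^sup>2)"
      using * pos by (intro mult_left_mono) auto
    finally show ?thesis by (simp add: s_def algebra_simps)
  qed
  have c'_d': "- (2 * \<gamma> * (c' \<bullet> w + c' \<bullet> d')) \<le> \<gamma> * \<beta> / 2 * D'\<^sup>2"
  proof -
    let ?n = "N' c'"
    \<comment> \<open>Cocoercivity supplies \<open>inverse \<beta> * ?n\<^sup>2\<close>, which
      absorbs the cross term \<open>?n * D'\<close> at the cost of
      \<open>\<beta> / 4 * D'\<^sup>2\<close>.\<close>
    have "0 \<le> (2 * ?n - \<beta> * D')\<^sup>2 / (4 * \<beta>)" using pos by simp
    also have "\<dots> = inverse \<beta> * ?n\<^sup>2 - ?n * D' + \<beta> / 4 * D'\<^sup>2"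
      using pos by (simp add: field_simps power2_eq_square)
    also have "\<dots> \<le> c' \<bullet> w + c' \<bullet> d' + \<beta> / 4 * D'\<^sup>2"
      using c' dual_bound[of c' 1 ?n d'] by (simp add: D'_def abs_le_iff)
    finally have "0 \<le> 2 * \<gamma> * (c' \<bullet> w + c' \<bullet> d' + \<beta> / 4 * D'\<^sup>2)" using pos by simp
    then show ?thesis by (simp add: algebra_simps)
  qed
  have c_d': "- (2 * \<gamma> * ((c' - c) \<bullet> d')) \<le> \<gamma> * \<beta> / \<epsilon> * D\<^sup>2 + \<gamma> * \<beta> * \<epsilon> * D'\<^sup>2"
  proof -
    \<comment> \<open>Young's inequality with the free weight \<open>\<epsilon>\<close>, the source
      of the \<open>\<epsilon>2\<close>-dependence of \<open>p_k\<close>.\<close>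
    have "0 \<le> (D - \<epsilon> * D')\<^sup>2 / \<epsilon>" using pos by simp
    also have "\<dots> = D\<^sup>2 / \<epsilon> + \<epsilon> * D'\<^sup>2 - 2 * D * D'"
      using pos by (simp add: field_simps power2_eq_square)
    finally have *: "2 * D * D' \<le> D\<^sup>2 / \<epsilon> + \<epsilon> * D'\<^sup>2" by simp
    have "- (2 * \<gamma> * ((c' - c) \<bullet> d')) = 2 * \<gamma> * (- ((c' - c) \<bullet> d'))" by simp
    also have "\<dots> \<le> 2 * \<gamma> * (\<beta> * D * D')"
      using dual_bound[OF c, of d'] pos by (intro mult_left_mono) (auto simp: D_def D'_def)
    also have "\<dots> = \<gamma> * \<beta> * (2 * D * D')" by simp
    also have "\<dots> \<le> \<gamma> * \<beta> * (D\<^sup>2 / \<epsilon> + \<epsilon> * D'\<^sup>2)"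
      using * pos by (intro mult_left_mono) auto
    finally show ?thesis by (simp add: algebra_simps)
  qed
  have "0 \<le> \<gamma> * (b' \<bullet> (w + d))" using b' pos by simp
  from telescoping_estimate[OF strong mono this] u_d' u_e' b_e' c'_d' c_d'
  show ?thesis
    unfolding D_def[symmetric] D'_def[symmetric] E_def[symmetric] E'_def[symmetric]
    by (simp add: ring_distribs)
qed

text \<open>Controls the indefinite part of the energy from both sides. In use \<open>b\<close> is
  \<open>B y_{k-1} - B z\<close> and \<open>y_{k-1} - z = w - e\<close>, whence the form of the
  bound on \<open>b\<close>.\<close>

lemma energy_bounds:
  assumes u: "N' u \<le> l\<^sub>1 * N d" and u0: "N' u\<^sub>0 \<le> l\<^sub>0 * N d\<^sub>0"
    and l: "0 \<le> l\<^sub>1" "0 \<le> l\<^sub>0"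
    and b: "N' b \<le> \<mu> * (N w + N e)"
    and pos: "0 < \<gamma>" "0 < \<mu>"
  shows "\<bar>2 * (u \<bullet> w) + 2 * ((u - u\<^sub>0) \<bullet> d) + 2 * \<gamma> * (b \<bullet> d)\<bar>
    \<le> (l\<^sub>1 + \<gamma> * \<mu>) * (N w)\<^sup>2 + (3 * l\<^sub>1 + l\<^sub>0 + 2 * \<gamma> * \<mu>) * (N d)\<^sup>2
      + l\<^sub>0 * (N d\<^sub>0)\<^sup>2 + \<gamma> * \<mu> * (N e)\<^sup>2"
proof -
  have "\<bar>2 * \<gamma> * (b \<bullet> d)\<bar> = 2 * \<gamma> * \<bar>b \<bullet> d\<bar>" using pos by (simp add: abs_mult)
  also have "\<dots> \<le> 2 * \<gamma> * (\<mu> * (N w + N e) * N d)"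
    using dual_bound[OF b, of d] pos by (intro mult_left_mono) auto
  also have "\<dots> = \<gamma> * \<mu> * (2 * N w * N d + 2 * N e * N d)" by (simp add: algebra_simps)
  also have "\<dots> \<le> \<gamma> * \<mu> * ((N w)\<^sup>2 + (N d)\<^sup>2 + ((N e)\<^sup>2 + (N d)\<^sup>2))"
    using pos by (intro mult_left_mono add_mono sum_squares_bound) auto
  finally have "\<bar>2 * \<gamma> * (b \<bullet> d)\<bar>
      \<le> \<gamma> * \<mu> * (N w)\<^sup>2 + 2 * \<gamma> * \<mu> * (N d)\<^sup>2 + \<gamma> * \<mu> * (N e)\<^sup>2"
    by (simp add: algebra_simps)
  with dual_Young[OF u l(1), of w] dual_Young[OF u l(1), of d] dual_Young[OF u0 l(2), of d]
  show ?thesis unfolding inner_diff_left[of u u\<^sub>0] ring_distribs by linarith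
qed

end

section \<open>From a contracting energy to an R-linear rate\<close>

lemma R_linearly_converges_if_contracting_bound:
  fixes x :: "nat \<Rightarrow> 'a::real_normed_vector"
  assumes c: "0 < c" and bound: "\<And>n. c * (norm (x (n + m) - l))\<^sup>2 \<le> W n"
    and \<delta>: "0 < \<delta>" and contract: "\<And>n. (1 + \<delta>) * W (Suc n) \<le> W n"
  shows "R_linearly_converges x l"
proof -
  \<comment> \<open>The energy bounds the squared norm, so the rate is the square root of the
    contraction factor.\<close>
  define r where "r = 1 / sqrt (1 + \<delta>)"
  have r: "0 < r" "r < 1" "r\<^sup>2 = 1 / (1 + \<delta>)"
    using \<delta> by (auto simp: r_def power_divide)
  have W: "W n \<le> W 0 * (r ^ n)\<^sup>2" for n
  proof (induction n)
    case (Suc n)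
    have "W (Suc n) \<le> r\<^sup>2 * W n" using contract[of n] \<delta> by (simp add: r(3) field_simps)
    also have "\<dots> \<le> r\<^sup>2 * (W 0 * (r ^ n)\<^sup>2)" using Suc by (intro mult_left_mono) auto
    finally show ?case by (simp add: power_mult_distrib algebra_simps)
  qed simp
  have "0 \<le> c * (norm (x m - l))\<^sup>2" using c by simp
  then have W0: "0 \<le> W 0" using bound[of 0] by simp
  \<comment> \<open>Division by \<open>r ^ m\<close> makes up for the index shift
    \<open>k = n + m\<close>.\<close>
  define c0 where "c0 = sqrt (W 0 / c) / r ^ m"
  have c0: "0 \<le> c0" using W0 c r by (simp add: c0_def)
  have "norm (x k - l) \<le> c0 * r ^ k" if "k \<ge> m" for k
  proof -
    define n where "n = k - m"
    have k: "k = n + m" using that by (simp add: n_def)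
    have "(norm (x k - l))\<^sup>2 \<le> W 0 / c * (r ^ n)\<^sup>2"
      using bound[of n] W[of n] c by (simp add: k field_simps)
    also have "\<dots> = (c0 * r ^ k)\<^sup>2"
      using W0 c r by (simp add: c0_def k power_add power_mult_distrib power_divide)
    finally show ?thesis
      using c0 r by (meson less_imp_le mult_nonneg_nonneg power2_le_imp_le zero_le_power)
  qed
  then have "\<forall>\<^sub>F k in sequentially. norm (x k - l) \<le> c0 * r ^ k"
    by (auto simp: eventually_sequentially)
  then show ?thesis
    unfolding R_linearly_converges_def using c0 r by blast
qed

section \<open>Linear convergence of the iteration\<close>

theorem theorem3p4:
  fixes S B C :: "'a::{real_inner, complete_space} \<Rightarrow> 'a"
    and A :: "'a \<Rightarrow> 'a set"
    and M :: "nat \<Rightarrow> 'a \<Rightarrow> 'a"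
    and L :: "nat \<Rightarrow> real"
    and \<gamma> \<mu> \<beta> \<rho> \<epsilon> \<epsilon>2 \<epsilon>3 \<epsilon>4 t :: real
    and p q :: "nat \<Rightarrow> real"
    and x y u :: "nat \<Rightarrow> 'a"
    and x_minus1 :: 'a
  assumes S: "bounded_linear S" "self_adjoint S" "strongly_monotone_lin S"
    and A_max: "maximally_monotone A"
    and B_mono: "monotone_op (single B)"
    and \<mu>: "\<mu> > 0"
    and B_lip: "lipschitz_wrt S \<mu> B"
    and \<beta>: "\<beta> > 0"
    and C_coco: "cocoercive_wrt S (inverse \<beta>) C"
    and zer: "zer (op_plus (op_plus A (single B)) (single C)) \<noteq> {}"
    and \<gamma>: "\<gamma> > 0"
    and L: "\<And>k. 0 \<le> L k" "\<And>k. L k < 1"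
    and M_lip: "\<And>k. lipschitz_wrt S (L k) (\<lambda>z. \<gamma> *\<^sub>R M k z - S z)"
    and \<rho>: "\<rho> > 0"
    and A_strong: "strongly_monotone_wrt S \<rho> A"
    and y_0: "y 0 = 2 *\<^sub>R x 0 - x_minus1"
    and y_Suc: "\<And>k. y (Suc k) = 2 *\<^sub>R x (Suc k) - x k"
    and x_Suc: "\<And>k. x (Suc k) \<in> op_inverse (op_plus (single (M k)) A)
                        (M k (x k) - B (y k) - C (x k) + inverse \<gamma> *\<^sub>R u k)"
    and u_Suc: "\<And>k. u (Suc k) = (\<gamma> *\<^sub>R M k (x (Suc k)) - S (x (Suc k)))
                                 - (\<gamma> *\<^sub>R M k (x k) - S (x k))"
    and \<epsilon>2: "\<epsilon>2 > 0"
    and p: "\<And>k. k \<ge> 1 \<Longrightarrow>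
          p k = 1 - 3 * L k - (2 + \<epsilon>2 + 2 * \<epsilon>2\<^sup>2) * \<gamma> * \<beta> / (2 * \<epsilon>2)
                - L (k - 1) - \<gamma> * \<mu> * (sqrt 2 + 1)"
    and q: "\<And>k. k \<ge> 2 \<Longrightarrow>
          q k = 1 - L (k - 1) - L (k - 2) - \<gamma> * \<mu> * (sqrt 2 + 1)"
    and \<epsilon>: "\<epsilon> > 0"
    and p_ge: "\<And>k. k \<ge> 1 \<Longrightarrow> p k \<ge> \<epsilon>"
    and q_ge: "\<And>k. k \<ge> 2 \<Longrightarrow> q k \<ge> \<epsilon>"
    and \<epsilon>3: "\<epsilon>3 > 0"
    and \<epsilon>4: "\<epsilon>4 > 0"
    and t: "t = (INF k\<in>{2..}. Min {
              2 * \<gamma> * \<rho> / (1 + L k / \<epsilon>3 + 2 * \<epsilon>4 * \<gamma> * \<mu>),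
              p k / (1 + 5 * L (k - 1) + (\<epsilon>3 + 5) * L k + \<gamma> * \<beta>
                     + \<gamma> * \<mu> * (1 / \<epsilon>4 + sqrt 2 + 1)),
              q k / (\<gamma> * \<mu> * (2 * \<epsilon>4 + 1) + 4 * L (k - 1))})"
    and t_pos: "t > 0"
  shows "\<exists>xstar \<in> zer (op_plus (op_plus A (single B)) (single C)). R_linearly_converges x xstar"
proof -
  interpret energy_operator S using S by (rule energy_operator.intro)
  obtain z v where v: "v \<in> A z" and v_eq: "v = - B z - C z"
  proof -
    from zer obtain z v where v: "v \<in> A z" "v + B z + C z = 0"
      by (force simp: zer_def op_plus_def single_def)
    from v(2) have "v = - (B z + C z)" by (simp only: eq_neg_iff_add_eq_0 add.assoc)
    with v(1) show thesis using that[of v z] by simp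
  qed
  have z_zer: "z \<in> zer (op_plus (op_plus A (single B)) (single C))"
    using v v_eq by (force simp: zer_def op_plus_def single_def)
  have A: "\<rho> * (N (a - a'))\<^sup>2 \<le> (f - f') \<bullet> (a - a')" if "f \<in> A a" "f' \<in> A a'" for a a' f f'
    using A_strong that by (auto simp: strongly_monotone_wrt_def gra_def)
  have B: "0 \<le> (B a - B a') \<bullet> (a - a')" for a a'
    using B_mono by (auto simp: monotone_op_def gra_def single_def)
  have B_bd: "N' (B a - B a') \<le> \<mu> * N (a - a')" for a a'
    using B_lip by (simp add: lipschitz_wrt_def)
  have C: "inverse \<beta> * (N' (C a - C a'))\<^sup>2 \<le> (C a - C a') \<bullet> (a - a')" for a a'
    using C_coco by (simp add: cocoercive_wrt_def)
  have C_bd: "N' (C a - C a') \<le> \<beta> * N (a - a')" for a a'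
    using cocoercive_imp_lipschitz[OF C_coco \<beta>] by (simp add: lipschitz_wrt_def)

  \<comment> \<open>The element of \<open>A (x (Suc k))\<close> singled out by the resolvent
    inclusion. In \<open>f_eq\<close> the definition of \<open>u (Suc k)\<close> eliminates
    \<open>M k\<close> in favour of \<open>S\<close>.\<close>
  define f where "f k = M k (x k) - B (y k) - C (x k) + inverse \<gamma> *\<^sub>R u k - M k (x (Suc k))" for k
  have f_A: "f k \<in> A (x (Suc k))" for k
    using x_Suc[of k] by (auto simp: f_def op_inverse_def op_plus_def single_def)
  have f_eq: "\<gamma> *\<^sub>R f k = u k - u (Suc k) - S (x (Suc k) - x k) - \<gamma> *\<^sub>R B (y k) - \<gamma> *\<^sub>R C (x k)" for k
    using \<gamma> by (simp add: f_def u_Suc diff algebra_simps)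

  define w where "w k = x k - z" for k
  define d where "d k = x (Suc k) - x k" for k
  define e where "e k = x (Suc k) - y k" for k
  define b where "b k = B (y k) - B z" for k
  define c where "c k = C (x k) - C z" for k
  \<comment> \<open>Only indices from 1 on occur, since \<open>u 0\<close> is arbitrary.\<close>
  have u_bd: "N' (u (k + 1)) \<le> L k * N (d k)"
      "N' (u (k + 2)) \<le> L (k + 1) * N (d (k + 1))" for k
    using M_lip[of k] M_lip[of "k + 1"] u_Suc[of "k + 1"]
    by (simp_all add: lipschitz_wrt_def u_Suc d_def)
  have w_Suc: "w (Suc k) = w k + d k" for k by (simp add: w_def d_def)
  \<comment> \<open>Stated for successors because \<open>y 0\<close> involves
    \<open>x_minus1\<close>.\<close>
  have e_Suc: "e (Suc k) = d (Suc k) - d k" for k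
    by (simp add: e_def d_def y_Suc scaleR_2)
  have y_diff: "y (Suc (Suc k)) - y (Suc k) = d (Suc k) + e (Suc k)" for k
    by (simp add: e_def d_def y_Suc scaleR_2)

  \<comment> \<open>The energy and its decrease\<close>
  \<comment> \<open>The offset 2 makes both \<open>u (n + 1)\<close> and \<open>u (n + 2)\<close>
    bounded. Of the coefficient \<open>3 * L (n + 1)\<close>, two parts come from
    \<open>energy_step\<close> and one pays for the term
    \<open>L (n + 1) * (N (d (n + 1)))\<^sup>2\<close> of \<open>V (Suc n)\<close>.\<close>
  define V where "V n = (N (w (n + 2)))\<^sup>2 + 2 * (u (n + 2) \<bullet> w (n + 2))
      + 2 * ((u (n + 2) - u (n + 1)) \<bullet> d (n + 1)) + 2 * \<gamma> * (b (n + 1) \<bullet> d (n + 1))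
      + (1 + \<gamma> * \<mu> * (sqrt 2 + 1) + 3 * L (n + 1) + \<gamma> * \<beta> / \<epsilon>2) * (N (d (n + 1)))\<^sup>2
      + L n * (N (d n))\<^sup>2 + \<gamma> * \<mu> * (N (e (n + 1)))\<^sup>2" for n
  define Q where "Q n = (N (w (n + 2)))\<^sup>2 + (N (d (n + 1)))\<^sup>2 + (N (e (n + 1)))\<^sup>2" for n
  define \<eta> where "\<eta> = min \<epsilon> (2 * \<gamma> * \<rho>)"
  have \<eta>: "0 < \<eta>" "\<eta> \<le> \<epsilon>" "\<eta> \<le> 2 * \<gamma> * \<rho>" using \<epsilon> \<gamma> \<rho> by (auto simp: \<eta>_def)

  have decrease: "V (Suc n) + \<eta> * Q (Suc n) \<le> V n" for n
  proof -
    let ?k = "n + 2"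
    have strong: "\<gamma> * \<rho> * (N (w ?k + d ?k))\<^sup>2
      \<le> (u ?k - u (Suc ?k) - S (d ?k) - \<gamma> *\<^sub>R b ?k - \<gamma> *\<^sub>R c ?k) \<bullet> (w ?k + d ?k)"
    proof -
      have "\<gamma> * (\<rho> * (N (w (Suc ?k)))\<^sup>2) \<le> \<gamma> * ((f ?k - v) \<bullet> w (Suc ?k))"
        using A[OF f_A[of ?k] v] \<gamma> unfolding w_def by (intro mult_left_mono) auto
      also have "\<dots> = (\<gamma> *\<^sub>R f ?k - \<gamma> *\<^sub>R v) \<bullet> w (Suc ?k)"
        by (simp add: inner_diff_left algebra_simps)
      also have "\<gamma> *\<^sub>R f ?k - \<gamma> *\<^sub>R v
          = u ?k - u (Suc ?k) - S (d ?k) - \<gamma> *\<^sub>R b ?k - \<gamma> *\<^sub>R c ?k"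
        unfolding f_eq v_eq d_def b_def c_def by (simp add: algebra_simps)
      finally show ?thesis by (simp add: w_Suc mult.assoc)
    qed
    have mono: "0 \<le> (2 *\<^sub>R u ?k - u (Suc ?k) - u (n + 1) - S (d ?k) + S (d (n + 1))
        - \<gamma> *\<^sub>R (b ?k - b (n + 1)) - \<gamma> *\<^sub>R (c ?k - c (n + 1))) \<bullet> d ?k"
    proof -
      have "0 \<le> \<rho> * (N (d ?k))\<^sup>2" using \<rho> by simp
      also have "\<dots> \<le> (f ?k - f (n + 1)) \<bullet> d ?k"
        using A[OF f_A[of ?k] f_A[of "n + 1"]] by (simp add: d_def)
      finally have "0 \<le> \<gamma> * ((f ?k - f (n + 1)) \<bullet> d ?k)" using \<gamma> by simp
      also have "\<dots> = (\<gamma> *\<^sub>R f ?k - \<gamma> *\<^sub>R f (n + 1)) \<bullet> d ?k"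
        by (simp add: inner_diff_left algebra_simps)
      also have "\<gamma> *\<^sub>R f ?k - \<gamma> *\<^sub>R f (n + 1)
          = 2 *\<^sub>R u ?k - u (Suc ?k) - u (n + 1) - S (d ?k) + S (d (n + 1))
            - \<gamma> *\<^sub>R (b ?k - b (n + 1)) - \<gamma> *\<^sub>R (c ?k - c (n + 1))"
        unfolding f_eq d_def b_def c_def by (simp add: algebra_simps scaleR_2)
      finally show ?thesis .
    qed
    have "y ?k - z = w ?k + d (n + 1)"
      by (simp add: y_Suc w_def d_def scaleR_2)
    with B[of "y ?k" z] have b_mono: "0 \<le> b ?k \<bullet> (w ?k + d (n + 1))"
      by (simp add: b_def)
    have b_diff: "N' (b ?k - b (n + 1)) \<le> \<mu> * (N (d (n + 1)) + N (e (n + 1)))"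
    proof -
      have "N' (b ?k - b (n + 1)) \<le> \<mu> * N (d (n + 1) + e (n + 1))"
        using B_bd[of "y ?k" "y (n + 1)"] y_diff[of n] by (simp add: b_def)
      also have "\<dots> \<le> \<mu> * (N (d (n + 1)) + N (e (n + 1)))"
        using \<mu> by (intro mult_left_mono N_triangle) auto
      finally show ?thesis .
    qed
    have c_diff: "N' (c ?k - c (n + 1)) \<le> \<beta> * N (d (n + 1))"
      using C_bd[of "x ?k" "x (n + 1)"] by (simp add: c_def d_def)
    \<comment> \<open>Subtracting the coefficients in \<open>V (Suc n)\<close> from those on the
      left of \<open>energy_step\<close> leaves exactly \<open>p ?k\<close> and
      \<open>q ?k\<close>.\<close>
    have p': "p ?k = 1 - 3 * L ?k - \<gamma> * \<beta> / 2 - \<gamma> * \<beta> * \<epsilon>2 - \<gamma> * \<beta> / \<epsilon>2 - L (n + 1)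
        - \<gamma> * \<mu> * (sqrt 2 + 1)"
      using p[of ?k] \<epsilon>2 by (simp add: field_simps power2_eq_square)
    have q': "q ?k = 1 - L (n + 1) - L n - \<gamma> * \<mu> * (sqrt 2 + 1)"
      using q[of ?k] by simp
    have "V (Suc n) + 2 * \<gamma> * \<rho> * (N (w (n + 3)))\<^sup>2 + p ?k * (N (d ?k))\<^sup>2 + q ?k * (N (e ?k))\<^sup>2 \<le> V n"
      using energy_step[OF strong mono b_mono u_bd(2)[of n] u_bd(1)[of n] L(1) L(1) b_diff
          C[of "x ?k" z, folded c_def w_def] c_diff \<gamma> \<mu> \<beta> \<epsilon>2]
      unfolding V_def p' q' by (simp add: w_Suc e_Suc ring_distribs numeral_3_eq_3)
    moreover have "\<eta> * Q (Suc n)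
        \<le> 2 * \<gamma> * \<rho> * (N (w (n + 3)))\<^sup>2 + p ?k * (N (d ?k))\<^sup>2 + q ?k * (N (e ?k))\<^sup>2"
    proof -
      have "\<eta> * Q (Suc n) = \<eta> * (N (w (n + 3)))\<^sup>2 + \<eta> * (N (d ?k))\<^sup>2 + \<eta> * (N (e ?k))\<^sup>2"
        by (simp add: Q_def algebra_simps eval_nat_numeral)
      also have "\<dots> \<le> 2 * \<gamma> * \<rho> * (N (w (n + 3)))\<^sup>2 + p ?k * (N (d ?k))\<^sup>2 + q ?k * (N (e ?k))\<^sup>2"
        using \<eta> p_ge[of ?k] q_ge[of ?k] by (intro add_mono mult_right_mono) auto
      finally show ?thesis .
    qed
    ultimately show ?thesis by linarith
  qed

  \<comment> \<open>Two-sided bounds on the energy\<close>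
  \<comment> \<open>The largest coefficient in the upper bound is that of \<open>d (n + 1)\<close>,
    with constant part at most \<open>1 + 6 + 1\<close> because \<open>L k < 1\<close>.\<close>
  define K where "K = 8 + \<gamma> * \<mu> * (sqrt 2 + 3) + \<gamma> * \<beta> / \<epsilon>2"
  have V_bounds: "\<epsilon> * (N (w (n + 2)))\<^sup>2 \<le> V n" "V n \<le> K * (Q n + (N (d n))\<^sup>2)" for n
  proof -
    have "N' (b (n + 1)) \<le> \<mu> * N (w (n + 2) - e (n + 1))"
      using B_bd[of "y (n + 1)" z] by (simp add: b_def w_def e_def)
    also have "\<dots> \<le> \<mu> * (N (w (n + 2)) + N (e (n + 1)))"
      using N_triangle[of "w (n + 2)" "- e (n + 1)"] N_minus_commute[of 0 "e (n + 1)"] \<mu>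
      by (intro mult_left_mono) auto
    finally have bb: "N' (b (n + 1)) \<le> \<mu> * (N (w (n + 2)) + N (e (n + 1)))" .
    have bnd: "\<bar>2 * (u (n + 2) \<bullet> w (n + 2)) + 2 * ((u (n + 2) - u (n + 1)) \<bullet> d (n + 1))
        + 2 * \<gamma> * (b (n + 1) \<bullet> d (n + 1))\<bar>
      \<le> (L (n + 1) + \<gamma> * \<mu>) * (N (w (n + 2)))\<^sup>2
        + (3 * L (n + 1) + L n + 2 * \<gamma> * \<mu>) * (N (d (n + 1)))\<^sup>2
        + L n * (N (d n))\<^sup>2 + \<gamma> * \<mu> * (N (e (n + 1)))\<^sup>2"
      using energy_bounds[OF u_bd(2)[of n] u_bd(1)[of n] L(1) L(1)
          _ \<gamma> \<mu>, of "b (n + 1)" "w (n + 2)" "e (n + 1)"] bb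
      by simp
    have pos: "0 < \<gamma> * \<mu>" "0 < \<gamma> * \<beta> / \<epsilon>2" using \<gamma> \<mu> \<beta> \<epsilon>2 by auto
    have s2: "1 \<le> sqrt (2::real)" by simp
    have q2: "\<epsilon> \<le> 1 - L (n + 1) - L n - \<gamma> * \<mu> * (sqrt 2 + 1)"
      using q[of "n + 2"] q_ge[of "n + 2"] by simp
    have gms: "\<gamma> * \<mu> \<le> \<gamma> * \<mu> * sqrt 2" using mult_left_mono[OF s2, of "\<gamma> * \<mu>"] pos(1) by simp
    \<comment> \<open>In the lower bound the squares of \<open>d n\<close> and
      \<open>e (n + 1)\<close> cancel exactly. The coefficient of \<open>w (n + 2)\<close> is at
      least \<open>q (n + 2)\<close>, that of \<open>d (n + 1)\<close> is nonnegative since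
      \<open>sqrt 2 + 1 \<ge> 2\<close>.\<close>
    have coeff: "\<epsilon> \<le> 1 - L (n + 1) - \<gamma> * \<mu>"
        "0 \<le> 1 - L n + \<gamma> * \<mu> * (sqrt 2 + 1) - 2 * (\<gamma> * \<mu>) + \<gamma> * \<beta> / \<epsilon>2"
      using q2 gms pos L(1)[of n] L(2)[of n] by (simp_all add: ring_distribs)
    have lower: "\<epsilon> * (N (w (n + 2)))\<^sup>2 \<le> (1 - L (n + 1) - \<gamma> * \<mu>) * (N (w (n + 2)))\<^sup>2"
        "0 \<le> (1 - L n + \<gamma> * \<mu> * (sqrt 2 + 1) - 2 * (\<gamma> * \<mu>) + \<gamma> * \<beta> / \<epsilon>2) * (N (d (n + 1)))\<^sup>2"
      using coeff by (auto intro: mult_right_mono mult_nonneg_nonneg)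
    show "\<epsilon> * (N (w (n + 2)))\<^sup>2 \<le> V n"
      using bnd lower unfolding V_def by (simp add: abs_le_iff ring_distribs)
    have coeffs: "1 + L (n + 1) + \<gamma> * \<mu> \<le> K"
        "1 + \<gamma> * \<mu> * (sqrt 2 + 1) + 6 * L (n + 1) + L n + 2 * (\<gamma> * \<mu>) + \<gamma> * \<beta> / \<epsilon>2 \<le> K"
        "2 * L n \<le> K" "2 * (\<gamma> * \<mu>) \<le> K"
      using pos gms L(1)[of n] L(2)[of n] L(1)[of "n + 1"] L(2)[of "n + 1"]
      by (simp_all add: K_def ring_distribs)
    have "V n \<le> (1 + L (n + 1) + \<gamma> * \<mu>) * (N (w (n + 2)))\<^sup>2
      + (1 + \<gamma> * \<mu> * (sqrt 2 + 1) + 6 * L (n + 1) + L n + 2 * (\<gamma> * \<mu>) + \<gamma> * \<beta> / \<epsilon>2)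
          * (N (d (n + 1)))\<^sup>2
      + 2 * L n * (N (d n))\<^sup>2 + 2 * (\<gamma> * \<mu>) * (N (e (n + 1)))\<^sup>2"
      using bnd unfolding V_def by (simp add: abs_le_iff ring_distribs)
    also have "\<dots> \<le> K * (N (w (n + 2)))\<^sup>2 + K * (N (d (n + 1)))\<^sup>2 + K * (N (d n))\<^sup>2
        + K * (N (e (n + 1)))\<^sup>2"
      using coeffs by (intro add_mono mult_right_mono) auto
    finally show "V n \<le> K * (Q n + (N (d n))\<^sup>2)"
      by (simp add: Q_def algebra_simps)
  qed

  \<comment> \<open>The decrease from \<open>V (n - 1)\<close> to \<open>V n\<close> does not control the term \<open>d n\<close> of \<open>V n\<close>, so half
     of the decrease one step earlier is kept in reserve for it.\<close>
  define W where "W n = V n + \<eta> / 2 * (N (d (n + 1)))\<^sup>2" for n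
  \<comment> \<open>Solves \<open>\<delta> * (K + \<eta> / 2) = \<eta> / 2\<close>, matching the
    upper bound of \<open>W (Suc n)\<close> with the guaranteed decrease of
    \<open>W\<close>.\<close>
  define \<delta> where "\<delta> = \<eta> / 2 / (K + \<eta> / 2)"
  have K: "0 < K" using \<gamma> \<mu> \<beta> \<epsilon>2 by (simp add: K_def add_pos_pos)
  have \<delta>: "0 < \<delta>" using \<eta> K by (simp add: \<delta>_def)
  have d_le_Q: "(N (d (n + 1)))\<^sup>2 \<le> Q n" for n by (simp add: Q_def)

  \<comment> \<open>Contraction of the corrected energy and the resulting rate\<close>
  have contract: "(1 + \<delta>) * W (Suc n) \<le> W n" for n
  proof -
    let ?R = "Q (Suc n) + (N (d (Suc n)))\<^sup>2"
    have "W (Suc n) \<le> K * ?R + \<eta> / 2 * (N (d (Suc (Suc n))))\<^sup>2"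
      using V_bounds(2)[of "Suc n"] by (simp add: W_def)
    also have "\<dots> \<le> K * ?R + \<eta> / 2 * ?R"
      using d_le_Q[of "Suc n"] \<eta> by (simp add: add_increasing2)
    finally have "W (Suc n) \<le> (K + \<eta> / 2) * ?R" by (simp only: ring_distribs)
    then have "\<delta> * W (Suc n) \<le> \<delta> * ((K + \<eta> / 2) * ?R)"
      using \<delta> by (intro mult_left_mono) auto
    also have "\<dots> = \<eta> / 2 * ?R"
    proof -
      have "\<delta> * (K + \<eta> / 2) = \<eta> / 2"
        using K \<eta>(1) unfolding \<delta>_def by (intro nonzero_eq_divide_eq[THEN iffD1, OF _ refl]) auto
      then show ?thesis by (simp only: mult.assoc[symmetric])
    qed
    finally have "\<delta> * W (Suc n) \<le> \<eta> / 2 * ?R" .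
    \<comment> \<open>Half of the decrease refills the reserve in \<open>W (Suc n)\<close>; the
      other half and the released reserve of \<open>W n\<close> give
      \<open>\<eta> / 2 * ?R\<close>.\<close>
    moreover have "\<eta> / 2 * (N (d (Suc (Suc n))))\<^sup>2 \<le> \<eta> / 2 * Q (Suc n)"
      using d_le_Q[of "Suc n"] \<eta> by (intro mult_left_mono) auto
    ultimately show ?thesis
      using decrease[of n] by (simp add: W_def ring_distribs add_divide_distrib)
  qed
  \<comment> \<open>The strong monotonicity constant of \<open>S\<close> converts \<open>N\<close>
    back to the norm of the space.\<close>
  obtain \<kappa> where \<kappa>: "0 < \<kappa>" "\<And>a. \<kappa> * (norm a)\<^sup>2 \<le> S a \<bullet> a"
    using S(3) unfolding strongly_monotone_lin_def by blast
  have bound: "\<epsilon> * \<kappa> * (norm (x (n + 2) - z))\<^sup>2 \<le> W n" for n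
  proof -
    have "\<epsilon> * (\<kappa> * (norm (x (n + 2) - z))\<^sup>2) \<le> \<epsilon> * (N (w (n + 2)))\<^sup>2"
      using \<kappa>(2) \<epsilon> unfolding N_sq w_def by (intro mult_left_mono) auto
    also have "\<dots> \<le> V n" by (rule V_bounds)
    also have "\<dots> \<le> W n" using \<eta> by (simp add: W_def)
    finally show ?thesis by (simp add: mult.assoc)
  qed
  have "0 < \<epsilon> * \<kappa>" using \<epsilon> \<kappa> by simp
  from R_linearly_converges_if_contracting_bound[OF this bound \<delta> contract] z_zer
  show ?thesis by blast
qed

end
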